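(* Let $\mathbb{F}$ be an algebraically closed field of characteristic not equal to $2$, let $V$ be a vector space over $\mathbb{F}$ of countably infinite dimension, and let $f:V\to\mathbb{F}$ be a nondegenerate quadratic form. Let $\psi:V\to V$ be a skew-symmetric linear transformation and let $D$ be the Bogolyubov derivation of $\mathcal{C}\ell(V,f)$ corresponding to $\psi$. Then $D$ is inner if and only if $\psi$ is finitary, that is, $\dim_{\mathbb{F}}\psi(V)<\infty$.
   Context: A quadratic form on $V$ is a map $f:V\to\mathbb{F}$ with $f(\lambda v)=\lambda^2 f(v)$ such that $f(v,w)=f(v+w)-f(v)-f(w)$ is bilinear; it is nondegenerate if the bilinear form $f(v,w)$ is nondegenerate. The Clifford algebra $\mathcal{C}\ell(V,f)$ is the unital associative $\mathbb{F}$-algebra generated by $V$ with defining relations $v^2=f(v)\cdot 1$, $v\in V$. A linear map $\psi:V\to V$ is skew-symmetric if $f(\psi(v),w)+f(v,\psi(w))=0$ for all $v,w\in V$; each such $\psi$ extends uniquely to a derivation of $\mathcal{C}\ell(V,f)$, called the Bogolyubov derivation corresponding to $\psi$. A derivation $D$ of an associative algebra $A$ is inner if there is $a\in A$ with $D(x)=ax-xa$ for all $x\in A$. *)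

theory Defs
  imports "HOL-Algebra.Algebraic_Closure_Type" "HOL-Library.Poly_Mapping"
    "HOL-Library.Countable_Set"
begin

section \<open>Quadratic spaces\<close>

definition polar_form :: "('v::ab_group_add \<Rightarrow> 'k::field) \<Rightarrow> 'v \<Rightarrow> 'v \<Rightarrow> 'k"
  where "polar_form f v w = f (v + w) - f v - f w"

definition quadratic_form ::
    "('k::field \<Rightarrow> 'v::ab_group_add \<Rightarrow> 'v) \<Rightarrow> ('v \<Rightarrow> 'k) \<Rightarrow> bool"
  where "quadratic_form scale f \<longleftrightarrow>
    (\<forall>c v. f (scale c v) = c\<^sup>2 * f v) \<and>
    (\<forall>w. Vector_Spaces.linear scale (*) (\<lambda>v. polar_form f v w)) \<and>
    (\<forall>v. Vector_Spaces.linear scale (*) (\<lambda>w. polar_form f v w))"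

definition nondegenerate :: "('v::ab_group_add \<Rightarrow> 'k::field) \<Rightarrow> bool"
  where "nondegenerate f \<longleftrightarrow> (\<forall>v. (\<forall>w. polar_form f v w = 0) \<longrightarrow> v = 0)"

definition skew_symmetric :: "('v::ab_group_add \<Rightarrow> 'k::field) \<Rightarrow> ('v \<Rightarrow> 'v) \<Rightarrow> bool"
  where "skew_symmetric f \<psi> \<longleftrightarrow>
    (\<forall>v w. polar_form f (\<psi> v) w + polar_form f v (\<psi> w) = 0)"

text \<open>Both dimension notions are phrased with bases, since \<open>vector_space.dim\<close> is a natural
  number and is \<open>0\<close> for every infinite-dimensional space.\<close>

definition (in vector_space) countably_infinite_dimensional :: bool
  where "countably_infinite_dimensional \<longleftrightarrow>
    (\<exists>B. independent B \<and> span B = UNIV \<and> countable B \<and> infinite B)"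

definition (in vector_space) finitary :: "('b \<Rightarrow> 'b) \<Rightarrow> bool"
  where "finitary \<psi> \<longleftrightarrow> (\<exists>B. finite B \<and> independent B \<and> span B = range \<psi>)"


section \<open>The Clifford algebra\<close>

text \<open>Words over \<open>'v\<close> form the free monoid on \<open>'v\<close>. It is written additively because the product
  on \<open>\<Rightarrow>\<^sub>0\<close> is convolution with respect to addition of the keys. Thus
  \<open>'v fmonoid \<Rightarrow>\<^sub>0 'k\<close> is the free unital associative \<open>'k\<close>-algebra on the set \<open>'v\<close>.\<close>

datatype 'v fmonoid = Word "'v list"

instantiation fmonoid :: (type) monoid_add
begin

definition zero_fmonoid :: "'a fmonoid"
  where "zero_fmonoid = Word []"

fun plus_fmonoid :: "'a fmonoid \<Rightarrow> 'a fmonoid \<Rightarrow> 'a fmonoid"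
  where "plus_fmonoid (Word xs) (Word ys) = Word (xs @ ys)"

instance
proof
  fix a b c :: "'a fmonoid"
  show "a + b + c = a + (b + c)"
    by (cases a; cases b; cases c) simp
  show "0 + a = a" "a + 0 = a"
    by (cases a; simp add: zero_fmonoid_def)+
qed

end

type_synonym ('v, 'k) free_alg = "'v fmonoid \<Rightarrow>\<^sub>0 'k"

definition free_gen :: "'v \<Rightarrow> ('v, 'k::field) free_alg"
  where "free_gen v = Poly_Mapping.single (Word [v]) 1"

definition free_const :: "'k::field \<Rightarrow> ('v, 'k) free_alg"
  where "free_const c = Poly_Mapping.single 0 c"

text \<open>The first two families of relations make \<open>free_gen\<close> linear, so that the algebra is generated by
  the vector space and not merely by its underlying set.\<close>

definition clifford_relations ::
    "('k::field \<Rightarrow> 'v::ab_group_add \<Rightarrow> 'v) \<Rightarrow> ('v \<Rightarrow> 'k) \<Rightarrow> ('v, 'k) free_alg set"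
  where "clifford_relations scale f =
    {free_gen (v + w) - (free_gen v + free_gen w) | v w. True} \<union>
    {free_gen (scale c v) - free_const c * free_gen v | c v. True} \<union>
    {free_gen v * free_gen v - free_const (f v) | v. True}"

definition clifford_ideal ::
    "('k::field \<Rightarrow> 'v::ab_group_add \<Rightarrow> 'v) \<Rightarrow> ('v \<Rightarrow> 'k) \<Rightarrow> ('v, 'k) free_alg set"
  where "clifford_ideal scale f = Idl\<^bsub>ring_of_type_algebra\<^esub> (clifford_relations scale f)"

definition clifford_class ::
    "('k::field \<Rightarrow> 'v::ab_group_add \<Rightarrow> 'v) \<Rightarrow> ('v \<Rightarrow> 'k) \<Rightarrow> ('v, 'k) free_alg
      \<Rightarrow> ('v, 'k) free_alg set"
  where "clifford_class scale f x = clifford_ideal scale f +>\<^bsub>ring_of_type_algebra\<^esub> x"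

text \<open>The record \<open>module\<close> of HOL-Algebra extends \<open>ring\<close>, so it serves as the signature of a
  (not necessarily commutative) algebra over the field \<open>'k\<close>.\<close>

definition clifford_algebra ::
    "('k::field \<Rightarrow> 'v::ab_group_add \<Rightarrow> 'v) \<Rightarrow> ('v \<Rightarrow> 'k)
      \<Rightarrow> ('k, ('v, 'k) free_alg set) module"
  where "clifford_algebra scale f =
    (let Q = ring_of_type_algebra Quot clifford_ideal scale f
     in ring.extend Q (module.fields (\<lambda>c Y. clifford_class scale f (free_const c) \<otimes>\<^bsub>Q\<^esub> Y)))"

definition clifford_embed ::
    "('k::field \<Rightarrow> 'v::ab_group_add \<Rightarrow> 'v) \<Rightarrow> ('v \<Rightarrow> 'k) \<Rightarrow> 'v \<Rightarrow> ('v, 'k) free_alg set"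
  where "clifford_embed scale f v = clifford_class scale f (free_gen v)"


section \<open>Derivations\<close>

definition derivation :: "('k, 'a) module \<Rightarrow> ('a \<Rightarrow> 'a) \<Rightarrow> bool"
  where "derivation A D \<longleftrightarrow>
    D \<in> carrier A \<rightarrow> carrier A \<and>
    (\<forall>x\<in>carrier A. \<forall>y\<in>carrier A. D (x \<oplus>\<^bsub>A\<^esub> y) = D x \<oplus>\<^bsub>A\<^esub> D y) \<and>
    (\<forall>c. \<forall>x\<in>carrier A. D (c \<odot>\<^bsub>A\<^esub> x) = c \<odot>\<^bsub>A\<^esub> D x) \<and>
    (\<forall>x\<in>carrier A. \<forall>y\<in>carrier A.
       D (x \<otimes>\<^bsub>A\<^esub> y) = (D x \<otimes>\<^bsub>A\<^esub> y) \<oplus>\<^bsub>A\<^esub> (x \<otimes>\<^bsub>A\<^esub> D y))"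

definition inner_derivation :: "('k, 'a) module \<Rightarrow> ('a \<Rightarrow> 'a) \<Rightarrow> bool"
  where "inner_derivation A D \<longleftrightarrow> derivation A D \<and>
    (\<exists>a\<in>carrier A. \<forall>x\<in>carrier A. D x = (a \<otimes>\<^bsub>A\<^esub> x) \<ominus>\<^bsub>A\<^esub> (x \<otimes>\<^bsub>A\<^esub> a))"

definition bogolyubov_derivation ::
    "('k::field \<Rightarrow> 'v::ab_group_add \<Rightarrow> 'v) \<Rightarrow> ('v \<Rightarrow> 'k) \<Rightarrow> ('v \<Rightarrow> 'v)
      \<Rightarrow> (('v, 'k) free_alg set \<Rightarrow> ('v, 'k) free_alg set) \<Rightarrow> bool"
  where "bogolyubov_derivation scale f \<psi> D \<longleftrightarrow>
    derivation (clifford_algebra scale f) D \<and>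
    (\<forall>v. D (clifford_embed scale f v) = clifford_embed scale f (\<psi> v))"

end

theory Submission
  imports Defs
begin

text \<open>Write \<open>\<langle>v, w\<rangle>\<close> for the polar form, so that \<open>v w + w v = \<langle>v, w\<rangle>\<close> in the Clifford algebra.

  If \<open>\<psi>\<close> is finitary, choose a basis \<open>E\<close> of its range and vectors \<open>d e\<close> dual to it, which exist
  because the form is nondegenerate (\<open>dual_vectors\<close>). Skew-symmetry gives both
  \<open>\<psi> v = - (\<Sum>e. \<langle>\<psi> (d e), v\<rangle> e)\<close> and \<open>\<psi> v = (\<Sum>e. \<langle>e, v\<rangle> \<psi> (d e))\<close>. Since
  \<open>[e u, v] = \<langle>u, v\<rangle> e - \<langle>e, v\<rangle> u\<close>, the commutator with \<open>- 1/2 (\<Sum>e. e \<psi> (d e))\<close> is \<open>\<psi>\<close> on the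
  generators (\<open>finitary_imp_inner_on_generators\<close>), and a derivation is determined by its values on
  generators (\<open>derivation_eq_commutator\<close>).

  Conversely, let \<open>D\<close> be the commutator with \<open>a\<close>, and let \<open>\<alpha>\<close> be the grade involution, the
  automorphism that is \<open>- 1\<close> on vectors. Only finitely many vectors occur in \<open>a\<close>. If \<open>v\<close> is
  orthogonal to all of them, it anticommutes with each, so \<open>v a = \<alpha> a v\<close> and therefore
  \<open>\<psi> v = (a - \<alpha> a) v\<close>. The left-hand side changes sign under \<open>\<alpha>\<close>, the right-hand side does not;
  hence \<open>\<psi> v\<close> vanishes in the Clifford algebra, and so in the vector space. Thus \<open>\<psi>\<close> is zero on a
  subspace of finite codimension and has finite rank (\<open>inner_imp_finitary\<close>).

  The second argument needs that vectors embed into the Clifford algebra. By nondegeneracy,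
  if \<open>v \<noteq> 0\<close> became zero, then so would some nonzero scalar \<open>\<langle>v, w\<rangle>\<close>. It is therefore enough
  that the algebra is not zero, and for this it acts on alternating multilinear forms by
  prepending an argument plus a contraction (\<open>one_notin_I\<close>).

  All computations take place in the free algebra, modulo the ideal of the relations.\<close>

section \<open>Ideals and quotients of a type-class ring\<close>

lemma ring_of_type_algebra_ring: "ring (ring_of_type_algebra :: 'a::ring_1 ring)"
proof -
  have "\<exists>y. x + y = 0" for x :: 'a
    using add.right_inverse by blast
  then show ?thesis
    unfolding ring_of_type_algebra_def
    by unfold_locales (auto simp: algebra_simps Units_def)
qed

lemma ring_of_type_algebra_minus:
  "\<ominus>\<^bsub>ring_of_type_algebra\<^esub> x = - x" "x \<ominus>\<^bsub>ring_of_type_algebra\<^esub> y = x - y"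
  for x y :: "'a::ring_1"
proof -
  interpret ring "ring_of_type_algebra :: 'a ring" by (rule ring_of_type_algebra_ring)
  show minus: "\<ominus>\<^bsub>ring_of_type_algebra\<^esub> x = - x" for x :: 'a
    by (rule minus_equality) (simp_all add: ring_of_type_algebra_def)
  show "x \<ominus>\<^bsub>ring_of_type_algebra\<^esub> y = x - y"
    by (simp add: a_minus_def minus) (simp add: ring_of_type_algebra_def)
qed

lemma type_ring_idealD:
  fixes I :: "'a::ring_1 set"
  assumes "ideal I ring_of_type_algebra"
  shows "0 \<in> I"
    and "x \<in> I \<Longrightarrow> y \<in> I \<Longrightarrow> x + y \<in> I"
    and "x \<in> I \<Longrightarrow> - x \<in> I"
    and "x \<in> I \<Longrightarrow> y * x \<in> I"
    and "x \<in> I \<Longrightarrow> x * y \<in> I"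
proof -
  interpret ideal I ring_of_type_algebra by fact
  show "0 \<in> I"
    using additive_subgroup.zero_closed[OF is_additive_subgroup] by (simp add: ring_of_type_algebra_def)
  show "x \<in> I \<Longrightarrow> y \<in> I \<Longrightarrow> x + y \<in> I"
    using additive_subgroup.a_closed[OF is_additive_subgroup, of x y] by (simp add: ring_of_type_algebra_def)
  show mult: "x \<in> I \<Longrightarrow> y * x \<in> I" for x y
    using I_l_closed[of x y] by (simp add: ring_of_type_algebra_def)
  show "x \<in> I \<Longrightarrow> x * y \<in> I"
    using I_r_closed[of x y] by (simp add: ring_of_type_algebra_def)
  show "x \<in> I \<Longrightarrow> - x \<in> I"
    using mult[of x "- 1"] by simp
qed

lemma type_ring_idealI:
  fixes J :: "'a::ring_1 set"
  assumes "0 \<in> J" "\<And>x y. x \<in> J \<Longrightarrow> y \<in> J \<Longrightarrow> x + y \<in> J"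
    and l: "\<And>x y. x \<in> J \<Longrightarrow> y * x \<in> J" and r: "\<And>x y. x \<in> J \<Longrightarrow> x * y \<in> J"
  shows "ideal J ring_of_type_algebra"
proof -
  let ?R = "ring_of_type_algebra :: 'a ring"
  have ring: "ring ?R" by (rule ring_of_type_algebra_ring)
  have "\<ominus>\<^bsub>?R\<^esub> x \<in> J" if "x \<in> J" for x
    using l[OF that, of "- 1"] by (simp add: ring_of_type_algebra_minus)
  then have inv: "inv\<^bsub>add_monoid ?R\<^esub> x \<in> J" if "x \<in> J" for x
    using that unfolding a_inv_def .
  have "subgroup J (add_monoid ?R)"
    by (rule group.subgroupI[OF abelian_group.a_group[OF ring.is_abelian_group[OF ring]]])
       (use assms inv in \<open>auto simp: ring_of_type_algebra_def a_inv_def\<close>)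
  then show ?thesis
    using l r by (intro idealI ring) (auto simp: ring_of_type_algebra_def)
qed

lemma type_ring_coset_eq_iff:
  fixes I :: "'a::ring_1 set"
  assumes "ideal I ring_of_type_algebra"
  shows "I +>\<^bsub>ring_of_type_algebra\<^esub> x = I +>\<^bsub>ring_of_type_algebra\<^esub> y \<longleftrightarrow> x - y \<in> I"
proof -
  interpret ideal I ring_of_type_algebra by fact
  have carr: "carrier (ring_of_type_algebra :: 'a ring) = UNIV"
    by (simp add: ring_of_type_algebra_def)
  have "I +>\<^bsub>ring_of_type_algebra\<^esub> x = I +>\<^bsub>ring_of_type_algebra\<^esub> y \<longleftrightarrow>
      x \<in> I +>\<^bsub>ring_of_type_algebra\<^esub> y"
    using a_repr_independence'[of x y] a_rcos_self[of x] by (auto simp: carr)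
  also have "\<dots> \<longleftrightarrow> x - y \<in> I"
    using a_rcos_module_minus[OF ring_axioms, of y x]
    by (simp add: carr ring_of_type_algebra_minus)
  finally show ?thesis .
qed

lemma ideal_clifford_ideal: "ideal (clifford_ideal scale f) ring_of_type_algebra"
  unfolding clifford_ideal_def
  by (rule ring.genideal_ideal[OF ring_of_type_algebra_ring])
     (simp add: ring_of_type_algebra_def)

lemma relations_subset_ideal: "clifford_relations scale f \<subseteq> clifford_ideal scale f"
  unfolding clifford_ideal_def
  by (rule ring.genideal_self[OF ring_of_type_algebra_ring])
     (simp add: ring_of_type_algebra_def)

lemma clifford_ideal_subset:
  "ideal J ring_of_type_algebra \<Longrightarrow> clifford_relations scale f \<subseteq> J \<Longrightarrow> clifford_ideal scale f \<subseteq> J"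
  unfolding clifford_ideal_def
  by (rule ring.genideal_minimal[OF ring_of_type_algebra_ring])

text \<open>The signature of the Clifford algebra acts on classes through representatives. Together
  with \<open>class_eq_iff\<close>, this turns statements about the quotient into congruences in the free algebra.\<close>
lemma clifford_algebra_ops:
  fixes scale :: "'k::field \<Rightarrow> 'v::ab_group_add \<Rightarrow> 'v" and f :: "'v \<Rightarrow> 'k"
  defines "A \<equiv> clifford_algebra scale f"
    and "cls \<equiv> clifford_class scale f"
  shows "carrier A = range cls"
    and "cls x \<oplus>\<^bsub>A\<^esub> cls y = cls (x + y)"
    and "cls x \<otimes>\<^bsub>A\<^esub> cls y = cls (x * y)"
    and "c \<odot>\<^bsub>A\<^esub> cls x = cls (free_const c * x)"
    and "cls x \<ominus>\<^bsub>A\<^esub> cls y = cls (x - y)"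
proof -
  define R where "R = (ring_of_type_algebra :: ('v, 'k) free_alg ring)"
  define I where "I = clifford_ideal scale f"
  interpret ideal I R unfolding R_def I_def by (rule ideal_clifford_ideal)
  interpret Q: ring "R Quot I" by (rule quotient_is_ring)
  have R: "carrier R = UNIV" "x \<oplus>\<^bsub>R\<^esub> y = x + y" "x \<otimes>\<^bsub>R\<^esub> y = x * y" "\<zero>\<^bsub>R\<^esub> = 0" for x y
    by (simp_all add: R_def ring_of_type_algebra_def)
  have A: "carrier A = carrier (R Quot I)" "monoid.mult A = monoid.mult (R Quot I)"
    "add A = add (R Quot I)" "zero A = zero (R Quot I)"
    "c \<odot>\<^bsub>A\<^esub> x = cls (free_const c) \<otimes>\<^bsub>A\<^esub> x" for c x
    by (simp_all add: A_def cls_def clifford_algebra_def Let_def R_def I_def ring.defs module.defs)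
  have cls: "cls x = I +>\<^bsub>R\<^esub> x" for x by (simp add: cls_def clifford_class_def R_def I_def)
  show carr: "carrier A = range cls"
    by (auto simp: A cls FactRing_def A_RCOSETS_def' R)
  show add: "cls x \<oplus>\<^bsub>A\<^esub> cls y = cls (x + y)" for x y
    by (simp add: A FactRing_def cls a_rcos_sum R)
  show mult: "cls x \<otimes>\<^bsub>A\<^esub> cls y = cls (x * y)" for x y
    by (simp add: A FactRing_def cls rcoset_mult_add R)
  show "c \<odot>\<^bsub>A\<^esub> cls x = cls (free_const c * x)"
    by (simp only: A(5) mult)
  have zero: "\<zero>\<^bsub>A\<^esub> = cls 0"
    using a_rcos_const[of 0] additive_subgroup.zero_closed[OF is_additive_subgroup]
    by (simp add: A FactRing_def cls R)
  have "\<ominus>\<^bsub>A\<^esub> cls y = \<ominus>\<^bsub>R Quot I\<^esub> cls y"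
    by (simp add: a_inv_def m_inv_def A)
  also have "\<dots> = cls (- y)"
    using add[of "- y" y] zero carr A(1,3,4) by (intro Q.minus_equality) auto
  finally show "cls x \<ominus>\<^bsub>A\<^esub> cls y = cls (x - y)"
    by (simp add: a_minus_def add)
qed

lemma derivationD:
  assumes "derivation A D" and "x \<in> carrier A"
  shows "D x \<in> carrier A"
    and "y \<in> carrier A \<Longrightarrow> D (x \<oplus>\<^bsub>A\<^esub> y) = D x \<oplus>\<^bsub>A\<^esub> D y"
    and "D (c \<odot>\<^bsub>A\<^esub> x) = c \<odot>\<^bsub>A\<^esub> D x"
    and "y \<in> carrier A \<Longrightarrow> D (x \<otimes>\<^bsub>A\<^esub> y) = (D x \<otimes>\<^bsub>A\<^esub> y) \<oplus>\<^bsub>A\<^esub> (x \<otimes>\<^bsub>A\<^esub> D y)"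
  using assms by (auto simp: derivation_def)

section \<open>The free algebra\<close>
lemma free_alg_induct [case_names single add]:
  fixes x :: "('v, 'k::field) free_alg"
  assumes single: "\<And>xs c. P (Poly_Mapping.single (Word xs) c)"
    and add: "\<And>x y. P x \<Longrightarrow> P y \<Longrightarrow> P (x + y)"
  shows "P x"
proof -
  have "P (\<Sum>w\<in>S. Poly_Mapping.single w (Poly_Mapping.lookup x w))" if "finite S" for S
    using that
  proof (induction S)
    case empty
    then show ?case using single[of "[]" 0] by simp
  next
    case (insert w S)
    then show ?case by (cases w) (simp add: single add)
  qed
  moreover have "x = (\<Sum>w\<in>Poly_Mapping.keys x. Poly_Mapping.single w (Poly_Mapping.lookup x w))"
    by (rule poly_mapping_eqI)
       (simp add: lookup_sum lookup_single when_def in_keys_iff)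
  ultimately show ?thesis by (metis finite_keys)
qed

text \<open>With \<open>single_Nil\<close>, this reduces an induction over words to products with one generator.\<close>
lemma single_Cons:
  "Poly_Mapping.single (Word (v # xs)) c = free_gen v * Poly_Mapping.single (Word xs) c"
  by (simp add: free_gen_def mult_single)

lemma single_Nil: "Poly_Mapping.single (Word []) c = free_const c"
  by (simp add: free_const_def zero_fmonoid_def)

lemma free_const_central: "free_const c * x = x * free_const c"
proof (induction x rule: free_alg_induct)
  case (single xs d)
  then show ?case by (simp add: free_const_def mult_single mult.commute)
qed (simp add: algebra_simps)

lemma free_const_simps:
  "free_const (c + d) = free_const c + free_const d" "free_const (- c) = - free_const c"
  "free_const (c * d) = free_const c * free_const d" "free_const 1 = 1" "free_const 0 = 0"
  by (simp_all add: free_const_def single_add single_uminus mult_single)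


section \<open>The action on alternating forms\<close>

text \<open>Expanding the recursion gives
  \<open>(\<Sum>j. (- 1) ^ j * b v (xs ! j) * L (xs without its entry j))\<close>. The form \<open>L\<close> is the last
  argument because the recursion changes it.\<close>
primrec contraction :: "('v \<Rightarrow> 'v \<Rightarrow> 'k::field) \<Rightarrow> 'v \<Rightarrow> 'v list \<Rightarrow> ('v list \<Rightarrow> 'k) \<Rightarrow> 'k" where
  "contraction b v [] L = 0"
| "contraction b v (x # xs) L = b v x * L xs - contraction b v xs (\<lambda>ys. L (x # ys))"

text \<open>On alternating forms the first summand is interior multiplication by \<open>v\<close>, and the second
  exterior multiplication by the functional \<open>b v\<close>. Their sum squares to \<open>b v v\<close> on alternating
  forms.\<close>
definition clifford_action :: "('v \<Rightarrow> 'v \<Rightarrow> 'k::field) \<Rightarrow> 'v \<Rightarrow> ('v list \<Rightarrow> 'k) \<Rightarrow> 'v list \<Rightarrow> 'k"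
  where "clifford_action b v L = (\<lambda>xs. L (v # xs) + contraction b v xs L)"

definition vacuum :: "'v list \<Rightarrow> 'k::field"
  where "vacuum xs = (if xs = [] then 1 else 0)"

definition linear_extension :: "('v list \<Rightarrow> 'k::field) \<Rightarrow> ('v, 'k) free_alg \<Rightarrow> 'k"
  where "linear_extension \<phi> x =
    (\<Sum>w\<in>Poly_Mapping.keys x. Poly_Mapping.lookup x w * (case w of Word xs \<Rightarrow> \<phi> xs))"

lemma linear_extension_add:
  "linear_extension \<phi> (x + y) = linear_extension \<phi> x + linear_extension \<phi> y"
proof -
  let ?S = "Poly_Mapping.keys x \<union> Poly_Mapping.keys y"
  have ext: "linear_extension \<phi> z =
      (\<Sum>w\<in>?S. Poly_Mapping.lookup z w * (case w of Word xs \<Rightarrow> \<phi> xs))"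
    if "Poly_Mapping.keys z \<subseteq> ?S" for z
    unfolding linear_extension_def
    by (rule sum.mono_neutral_left) (use that in \<open>auto simp: in_keys_iff\<close>)
  show ?thesis
    using keys_add[of x y]
    by (simp add: ext lookup_add algebra_simps sum.distrib)
qed

lemma linear_extension_single:
  "linear_extension \<phi> (Poly_Mapping.single (Word xs) c) = c * \<phi> xs"
  by (simp add: linear_extension_def)

lemma linear_extension_diff:
  "linear_extension \<phi> (x - y) = linear_extension \<phi> x - linear_extension \<phi> y"
  using linear_extension_add[of \<phi> "x - y" y] by simp

lemma contraction_add:
  "contraction b v xs (\<lambda>ys. L ys + M ys) = contraction b v xs L + contraction b v xs M"
  by (induction xs arbitrary: L M) (simp_all add: algebra_simps)

lemma contraction_scale:
  "contraction b v xs (\<lambda>ys. c * L ys) = c * contraction b v xs L"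
  by (induction xs arbitrary: L) (simp_all add: algebra_simps)

lemma contraction_zero: "contraction b v xs (\<lambda>ys. 0) = 0"
  by (induction xs) simp_all

lemma contraction_diff:
  "contraction b v xs (\<lambda>ys. L ys - M ys) = contraction b v xs L - contraction b v xs M"
  by (induction xs arbitrary: L M) (simp_all add: algebra_simps)

text \<open>Contraction anticommutes with prepending \<open>x\<close> up to the scalar \<open>b v x\<close>. Applying this twice, the
  scalar terms cancel, and the double contraction reduces to that of a form in fewer arguments.\<close>
lemma contraction_contraction:
  "contraction b v xs (\<lambda>ys. contraction b v ys L) = 0"
  by (induction xs arbitrary: L) (simp_all add: contraction_diff contraction_scale)

lemma clifford_action_add:
  "clifford_action b v (\<lambda>ys. L ys + M ys) =
    (\<lambda>xs. clifford_action b v L xs + clifford_action b v M xs)"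
  by (simp add: clifford_action_def contraction_add algebra_simps)

lemma clifford_action_scale:
  "clifford_action b v (\<lambda>ys. c * L ys) = (\<lambda>xs. c * clifford_action b v L xs)"
  by (simp add: clifford_action_def contraction_scale algebra_simps)

text \<open>The three conditions mirror the three families of Clifford relations.\<close>
definition alternating_forms ::
    "('k::field \<Rightarrow> 'v::ab_group_add \<Rightarrow> 'v) \<Rightarrow> ('v list \<Rightarrow> 'k) set"
  where "alternating_forms scale = {L.
    (\<forall>p x y q. L (p @ (x + y) # q) = L (p @ x # q) + L (p @ y # q)) \<and>
    (\<forall>p c x q. L (p @ scale c x # q) = c * L (p @ x # q)) \<and>
    (\<forall>p x q. L (p @ x # x # q) = 0)}"

definition clifford_word ::
    "('v \<Rightarrow> 'v \<Rightarrow> 'k::field) \<Rightarrow> 'v list \<Rightarrow> ('v list \<Rightarrow> 'k) \<Rightarrow> 'v list \<Rightarrow> 'k"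
  where "clifford_word b = foldr (clifford_action b)"

lemma clifford_word_simps:
  "clifford_word b [] L = L"
  "clifford_word b (v # xs) L = clifford_action b v (clifford_word b xs L)"
  "clifford_word b (xs @ ys) L = clifford_word b xs (clifford_word b ys L)"
  by (simp_all add: clifford_word_def)

lemma clifford_word_add:
  "clifford_word b xs (\<lambda>ys. L ys + M ys) = (\<lambda>zs. clifford_word b xs L zs + clifford_word b xs M zs)"
  by (induction xs) (simp_all add: clifford_word_simps clifford_action_add)

lemma clifford_word_scale:
  "clifford_word b xs (\<lambda>ys. c * L ys) = (\<lambda>zs. c * clifford_word b xs L zs)"
  by (induction xs) (simp_all add: clifford_word_simps clifford_action_scale)

lemma alternating_formsD:
  assumes "L \<in> alternating_forms scale"
  shows "L (p @ (x + y) # q) = L (p @ x # q) + L (p @ y # q)"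
    and "L (p @ scale c x # q) = c * L (p @ x # q)"
    and "L (p @ x # x # q) = 0"
  using assms by (simp_all add: alternating_forms_def)

lemma alternating_forms_Cons:
  assumes "L \<in> alternating_forms scale"
  shows "(\<lambda>xs. L (v # xs)) \<in> alternating_forms scale"
  using alternating_formsD[OF assms, of "v # p" for p] by (simp add: alternating_forms_def)

lemma vacuum_alternating: "vacuum \<in> alternating_forms scale"
  by (simp add: alternating_forms_def vacuum_def)

text \<open>That 2 is nonzero makes the quadratic form the diagonal of half its polar form, and lets an element equal to its own negative vanish.\<close>
locale quadratic_space = vector_space scale
  for scale :: "'k::field \<Rightarrow> 'v::ab_group_add \<Rightarrow> 'v" +
  fixes f :: "'v \<Rightarrow> 'k"
  assumes quadratic: "quadratic_form scale f"
    and two_nonzero: "(2::'k) \<noteq> 0"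
begin

abbreviation B :: "'v \<Rightarrow> 'v \<Rightarrow> 'k" where "B \<equiv> polar_form f"

lemma polar_add_left: "B (x + y) w = B x w + B y w"
  and polar_scale_left: "B (scale c x) w = c * B x w"
proof -
  have "module_hom scale (*) (\<lambda>v. B v w)"
    using quadratic by (simp add: quadratic_form_def linear_iff_module_hom)
  then show "B (x + y) w = B x w + B y w" "B (scale c x) w = c * B x w"
    using module_hom.add[of scale "(*)" "\<lambda>v. B v w"] module_hom.scale[of scale "(*)" "\<lambda>v. B v w"]
    by blast+
qed

lemma polar_commute: "B v w = B w v"
  by (simp add: polar_form_def add.commute)

lemma polar_add_right: "B w (x + y) = B w x + B w y"
  and polar_scale_right: "B w (scale c x) = c * B w x"
  using polar_add_left polar_scale_left by (simp_all add: polar_commute[of w])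

lemma polar_zero: "B 0 w = 0" "B w 0 = 0"
  using polar_scale_left[of 0 0 w] polar_scale_right[of w 0 0] by simp_all

lemma polar_diff_left: "B (x - y) w = B x w - B y w"
  using polar_add_left[of "x - y" y w] by simp

lemma polar_diff_right: "B w (x - y) = B w x - B w y"
  using polar_add_right[of w "x - y" y] by simp

lemma polar_sum_left: "B (sum g S) w = (\<Sum>i\<in>S. B (g i) w)"
  by (induction S rule: infinite_finite_induct) (simp_all add: polar_zero polar_add_left)

lemma polar_sum_right: "B w (sum g S) = (\<Sum>i\<in>S. B w (g i))"
  by (induction S rule: infinite_finite_induct) (simp_all add: polar_zero polar_add_right)

lemma polar_same: "B v v = 2 * f v"
proof -
  have "f (v + v) = f (scale 2 v)"
    using scale_left_distrib[of 1 1 v] by simp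
  then show ?thesis
    using quadratic by (simp add: polar_form_def quadratic_form_def)
qed

abbreviation half :: "'v \<Rightarrow> 'v \<Rightarrow> 'k" where "half \<equiv> \<lambda>v w. B v w / 2"

text \<open>Each condition is shown by induction on the arguments before the affected position: the recursion
  of the contraction peels off the first one, and fixing it in \<open>L\<close> leaves an alternating form. At the
  affected position itself, the term with \<open>B v x\<close> supplies additivity and homogeneity; for a
  repeated argument it occurs twice with opposite signs.\<close>
lemma contraction_alternating:
  assumes "L \<in> alternating_forms scale"
  shows "(\<lambda>xs. contraction half v xs L) \<in> alternating_forms scale"
proof -
  have add: "contraction half v (p @ (x + y) # q) L =
      contraction half v (p @ x # q) L + contraction half v (p @ y # q) L" for p x y q
    using assms
  proof (induction p arbitrary: L)
    case Nil
    then show ?case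
      using alternating_formsD(1)[OF Nil, of "[]"]
      by (simp add: contraction_add polar_add_right field_simps)
  next
    case (Cons z p)
    then show ?case
      using Cons.IH[OF alternating_forms_Cons[OF Cons.prems, of z]]
      by (simp add: alternating_formsD algebra_simps)
  qed
  have scale: "contraction half v (p @ scale c x # q) L = c * contraction half v (p @ x # q) L"
    for p c x q
    using assms
  proof (induction p arbitrary: L)
    case Nil
    then show ?case
      using alternating_formsD(2)[OF Nil, of "[]"]
      by (simp add: contraction_scale polar_scale_right field_simps)
  next
    case (Cons z p)
    then show ?case
      using Cons.IH[OF alternating_forms_Cons[OF Cons.prems, of z]]
      by (simp add: alternating_formsD algebra_simps)
  qed
  have alt: "contraction half v (p @ x # x # q) L = 0" for p x q
    using assms
  proof (induction p arbitrary: L)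
    case Nil
    then show ?case
      using alternating_formsD(3)[OF Nil, of "[]"] by (simp add: contraction_zero)
  next
    case (Cons z p)
    then show ?case
      using Cons.IH[OF alternating_forms_Cons[OF Cons.prems, of z]]
      by (simp add: alternating_formsD)
  qed
  show ?thesis
    unfolding alternating_forms_def by (simp add: add scale alt)
qed

lemma clifford_action_alternating:
  assumes "L \<in> alternating_forms scale"
  shows "clifford_action half v L \<in> alternating_forms scale"
  using alternating_forms_Cons[OF assms, of v] contraction_alternating[OF assms, of v]
  unfolding clifford_action_def alternating_forms_def by (simp add: algebra_simps)

lemma clifford_word_alternating:
  "L \<in> alternating_forms scale \<Longrightarrow> clifford_word half xs L \<in> alternating_forms scale"
  by (induction xs) (simp_all add: clifford_word_simps clifford_action_alternating)

text \<open>The square of prepending vanishes by alternation, the square of contraction always, and the mixed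
  terms add up to \<open>half v v = f v\<close>.\<close>
lemma clifford_action_square:
  assumes "L \<in> alternating_forms scale"
  shows "clifford_action half v (clifford_action half v L) = (\<lambda>xs. f v * L xs)"
proof
  fix xs
  have "L (v # v # xs) = 0"
    using alternating_formsD(3)[OF assms, of "[]"] by simp
  then show "clifford_action half v (clifford_action half v L) xs = f v * L xs"
    using two_nonzero
    by (simp add: clifford_action_def contraction_add contraction_contraction polar_same)
qed

lemma clifford_action_plus:
  assumes "L \<in> alternating_forms scale"
  shows "clifford_action half (v + w) L =
    (\<lambda>xs. clifford_action half v L xs + clifford_action half w L xs)"
proof -
  have "contraction half (v + w) xs L = contraction half v xs L + contraction half w xs L" for xs
    by (induction xs arbitrary: L) (simp_all add: polar_add_left field_simps)
  then show ?thesis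
    using alternating_formsD(1)[OF assms, of "[]"] by (simp add: clifford_action_def fun_eq_iff)
qed

lemma clifford_action_smult:
  assumes "L \<in> alternating_forms scale"
  shows "clifford_action half (scale c v) L = (\<lambda>xs. c * clifford_action half v L xs)"
proof -
  have "contraction half (scale c v) xs L = c * contraction half v xs L" for xs
    by (induction xs arbitrary: L) (simp_all add: polar_scale_left field_simps)
  then show ?thesis
    using alternating_formsD(2)[OF assms, of "[]"]
    by (simp add: clifford_action_def fun_eq_iff distrib_left)
qed

text \<open>This is the degree-0 part of the result of acting on the vacuum: on a word it is the
  sum over perfect matchings of its letters of signed products of values of \<open>half\<close>, a Pfaffian.\<close>
definition vacuum_expectation :: "('v, 'k) free_alg \<Rightarrow> 'k"
  where "vacuum_expectation = linear_extension (\<lambda>xs. clifford_word half xs vacuum [])"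

lemma vacuum_expectation_one: "vacuum_expectation 1 = 1"
  using linear_extension_single[of "\<lambda>xs. clifford_word half xs vacuum []" "[]" 1]
  by (simp add: vacuum_expectation_def clifford_word_simps vacuum_def flip: zero_fmonoid_def)

text \<open>On both sides of a relation it suffices to take words, by linearity. The right-hand word turns
  the vacuum into an alternating form, on which the relation acts as zero.\<close>
lemma vacuum_expectation_relations:
  assumes "r \<in> clifford_relations scale f"
  shows "vacuum_expectation (y * r * z) = 0"
proof -
  have words: "vacuum_expectation
      (Poly_Mapping.single (Word p) c * r * Poly_Mapping.single (Word q) d) = 0" for p q c d
  proof -
    define L where "L = clifford_word half q vacuum"
    have L: "L \<in> alternating_forms scale"
      by (simp add: L_def clifford_word_alternating vacuum_alternating)
    note simps = vacuum_expectation_def linear_extension_single linear_extension_diff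
      linear_extension_add free_gen_def free_const_def mult_single left_diff_distrib
      right_diff_distrib distrib_left distrib_right zero_fmonoid_def clifford_word_simps
    from assms show ?thesis
      unfolding clifford_relations_def
      by (auto simp: simps clifford_word_add clifford_word_scale clifford_action_square[OF L]
        clifford_action_plus[OF L] clifford_action_smult[OF L] simp flip: L_def)
  qed
  have "vacuum_expectation (y * r * Poly_Mapping.single (Word q) d) = 0" for q d
    by (induction y rule: free_alg_induct)
       (simp_all add: words distrib_right,
        simp add: vacuum_expectation_def linear_extension_add)
  then show ?thesis
    by (induction z rule: free_alg_induct)
       (simp_all add: distrib_left, simp add: vacuum_expectation_def linear_extension_add)
qed



section \<open>Congruence modulo the Clifford ideal\<close>
abbreviation I :: "('v, 'k) free_alg set" where "I \<equiv> clifford_ideal scale f"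
abbreviation A :: "('k, ('v, 'k) free_alg set) module" where "A \<equiv> clifford_algebra scale f"
abbreviation cls :: "('v, 'k) free_alg \<Rightarrow> ('v, 'k) free_alg set"
  where "cls \<equiv> clifford_class scale f"

lemmas I_closed = type_ring_idealD[OF ideal_clifford_ideal[of scale f]]

text \<open>The elements that have vacuum expectation 0 in every context form an ideal, which contains the
  relations and does not contain 1.\<close>
lemma one_notin_I: "1 \<notin> I"
proof
  define J where "J = {x. \<forall>y z. vacuum_expectation (y * x * z) = 0}"
  have "ideal J ring_of_type_algebra"
  proof (rule type_ring_idealI)
    show "0 \<in> J"
      by (simp add: J_def vacuum_expectation_def linear_extension_def)
    show "x + y \<in> J" if "x \<in> J" "y \<in> J" for x y
      using that by (simp add: J_def vacuum_expectation_def linear_extension_add distrib_left distrib_right)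
    show "y * x \<in> J" "x * y \<in> J" if "x \<in> J" for x y
      using that by (simp_all add: J_def mult.assoc) (simp flip: mult.assoc)
  qed
  then have "I \<subseteq> J"
    by (rule clifford_ideal_subset) (auto simp: J_def vacuum_expectation_relations)
  moreover assume "1 \<in> I"
  ultimately have "vacuum_expectation (1 * 1 * 1) = 0" unfolding J_def by blast
  then show False by (simp add: vacuum_expectation_one)
qed

definition cong :: "('v, 'k) free_alg \<Rightarrow> ('v, 'k) free_alg \<Rightarrow> bool"  (infix \<open>\<approx>\<close> 50)
  where "x \<approx> y \<longleftrightarrow> x - y \<in> I"

lemma cong_refl [simp]: "x \<approx> x"
  by (simp add: cong_def I_closed)

lemma cong_sym: "x \<approx> y \<Longrightarrow> y \<approx> x"
  using I_closed(3)[of "x - y"] by (simp add: cong_def)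

lemma cong_trans [trans]: "x \<approx> y \<Longrightarrow> y \<approx> z \<Longrightarrow> x \<approx> z"
  using I_closed(2)[of "x - y" "y - z"] by (simp add: cong_def)

lemma cong_add: "x \<approx> x' \<Longrightarrow> y \<approx> y' \<Longrightarrow> x + y \<approx> x' + y'"
  using I_closed(2)[of "x - x'" "y - y'"] by (simp add: cong_def algebra_simps)

lemma cong_minus: "x \<approx> x' \<Longrightarrow> - x \<approx> - x'"
  using I_closed(3)[of "x - x'"] by (simp add: cong_def)

lemma cong_diff: "x \<approx> x' \<Longrightarrow> y \<approx> y' \<Longrightarrow> x - y \<approx> x' - y'"
  using cong_add[of x x' "- y" "- y'"] cong_minus by simp

lemma cong_mult: "x \<approx> x' \<Longrightarrow> y \<approx> y' \<Longrightarrow> x * y \<approx> x' * y'"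
  using I_closed(2)[OF I_closed(5)[of "x - x'" y] I_closed(4)[of "y - y'" x']]
  by (simp add: cong_def algebra_simps)

lemma cong_sum: "(\<And>i. i \<in> S \<Longrightarrow> g i \<approx> h i) \<Longrightarrow> sum g S \<approx> sum h S"
  by (induction S rule: infinite_finite_induct) (simp_all add: cong_add)

lemma class_eq_iff: "cls x = cls y \<longleftrightarrow> x \<approx> y"
  unfolding clifford_class_def cong_def
  by (rule type_ring_coset_eq_iff[OF ideal_clifford_ideal])

lemma gen_add: "free_gen (v + w) \<approx> free_gen v + free_gen w"
  and gen_scale: "free_gen (scale c v) \<approx> free_const c * free_gen v"
  and gen_square: "free_gen v * free_gen v \<approx> free_const (f v)"
  using relations_subset_ideal[of scale f] by (auto simp: cong_def clifford_relations_def)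

lemma gen_sum: "free_gen (sum g S) \<approx> (\<Sum>i\<in>S. free_gen (g i))"
proof (induction S rule: infinite_finite_induct)
  case (insert i S)
  have "free_gen (g i + sum g S) \<approx> free_gen (g i) + free_gen (sum g S)"
    by (rule gen_add)
  also have "\<dots> \<approx> free_gen (g i) + (\<Sum>i\<in>S. free_gen (g i))"
    by (intro cong_add insert cong_refl)
  finally show ?case using insert by simp
qed (use gen_scale[of 0 0] in \<open>simp_all add: free_const_simps\<close>)

lemma gen_anticommutator:
  "free_gen v * free_gen w + free_gen w * free_gen v \<approx> free_const (B v w)"
proof -
  have "free_gen v * free_gen w + free_gen w * free_gen v
      = (free_gen v + free_gen w) * (free_gen v + free_gen w)
        - free_gen v * free_gen v - free_gen w * free_gen w"
    by (simp add: algebra_simps)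
  also have "\<dots> \<approx> free_gen (v + w) * free_gen (v + w)
      - free_gen v * free_gen v - free_gen w * free_gen w"
    by (intro cong_diff cong_mult cong_sym[OF gen_add] cong_refl)
  also have "\<dots> \<approx> free_const (f (v + w)) - free_const (f v) - free_const (f w)"
    by (intro cong_diff gen_square)
  also have "\<dots> = free_const (B v w)"
  proof -
    have "(free_const (f (v + w)) :: ('v, 'k) free_alg) =
        free_const (B v w) + free_const (f v) + free_const (f w)"
      by (simp only: free_const_simps(1)[symmetric]) (simp add: polar_form_def)
    then show ?thesis by simp
  qed
  finally show ?thesis .
qed

lemma const_cong_zero: "free_const c \<approx> 0 \<Longrightarrow> c = 0"
proof (rule ccontr)
  assume "free_const c \<approx> 0" "c \<noteq> 0"
  then have "free_const (inverse c) * free_const c \<in> I"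
    by (intro I_closed) (simp add: cong_def)
  then have "1 \<in> I"
    using \<open>c \<noteq> 0\<close> by (simp add: free_const_simps flip: free_const_simps(3))
  then show False using one_notin_I by simp
qed

text \<open>If a vector vanishes in the Clifford algebra, so do its anticommutators, which are its scalar
  products with all vectors.\<close>
lemma gen_cong_zero:
  assumes "nondegenerate f" "free_gen v \<approx> 0"
  shows "v = 0"
proof -
  have "B v w = 0" for w
  proof (rule const_cong_zero)
    have "free_const (B v w) \<approx> free_gen v * free_gen w + free_gen w * free_gen v"
      by (rule cong_sym[OF gen_anticommutator])
    also have "\<dots> \<approx> 0 * free_gen w + free_gen w * 0"
      by (intro cong_add cong_mult assms cong_refl)
    finally show "free_const (B v w) \<approx> 0" by simp
  qed
  then show ?thesis using assms(1) by (simp add: nondegenerate_def)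
qed

lemma cong_neg_self:
  assumes "x \<approx> - x"
  shows "x \<approx> 0"
proof -
  have "free_const (1 / 2 :: 'k) + free_const (1 / 2) = (1 :: ('v, 'k) free_alg)"
    using two_nonzero by (simp add: free_const_simps flip: free_const_simps(1))
  then have "x = (free_const (1 / 2) + free_const (1 / 2)) * x" by simp
  then have "x = free_const (1 / 2) * (x + x)" by (simp only: distrib_left distrib_right)
  moreover have "x + x \<in> I"
    using assms by (simp add: cong_def)
  ultimately show ?thesis
    using I_closed(4) by (metis cong_def diff_0_right)
qed

end

section \<open>The grade involution\<close>
definition grade_involution :: "('v, 'k::field) free_alg \<Rightarrow> ('v, 'k) free_alg"
  where "grade_involution =
    Poly_Mapping.mapp (\<lambda>w c. case w of Word xs \<Rightarrow> (- 1) ^ length xs * c)"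

lemma lookup_grade_involution:
  "Poly_Mapping.lookup (grade_involution x) w =
    (case w of Word xs \<Rightarrow> (- 1) ^ length xs * Poly_Mapping.lookup x w)"
  by (simp add: grade_involution_def lookup_mapp when_def in_keys_iff split: fmonoid.split)

lemma grade_involution_add: "grade_involution (x + y) = grade_involution x + grade_involution y"
  by (rule poly_mapping_eqI)
     (simp add: lookup_grade_involution lookup_add distrib_left split: fmonoid.split)

lemma grade_involution_zero: "grade_involution 0 = 0"
  by (rule poly_mapping_eqI) (simp add: lookup_grade_involution split: fmonoid.split)

lemma grade_involution_minus: "grade_involution (- x) = - grade_involution x"
  by (rule poly_mapping_eqI) (simp add: lookup_grade_involution split: fmonoid.split)

lemma grade_involution_diff: "grade_involution (x - y) = grade_involution x - grade_involution y"
  using grade_involution_add[of x "- y"] by (simp add: grade_involution_minus)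

lemma grade_involution_single:
  "grade_involution (Poly_Mapping.single (Word xs) c) =
    Poly_Mapping.single (Word xs) ((- 1) ^ length xs * c)"
  by (rule poly_mapping_eqI)
     (simp add: lookup_grade_involution lookup_single when_def split: fmonoid.split)

lemma grade_involution_mult: "grade_involution (x * y) = grade_involution x * grade_involution y"
proof (induction x rule: free_alg_induct)
  case (single xs c)
  show ?case
    by (induction y rule: free_alg_induct)
       (simp_all add: mult_single grade_involution_single grade_involution_add distrib_left
         power_add mult_ac)
qed (simp add: grade_involution_add distrib_right)

lemma grade_involution_involution: "grade_involution (grade_involution x) = x"
  by (rule poly_mapping_eqI)
     (simp add: lookup_grade_involution flip: power_mult_distrib mult.assoc split: fmonoid.split)

lemma grade_involution_gen: "grade_involution (free_gen v) = - free_gen v"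
  by (simp add: free_gen_def grade_involution_single single_uminus)

lemma grade_involution_const: "grade_involution (free_const c) = free_const c"
  by (simp add: grade_involution_single flip: single_Nil)

context quadratic_space
begin

text \<open>The relations are homogeneous modulo 2, so the involution fixes each of them up to sign and
  preserves the ideal.\<close>
lemma grade_involution_cong:
  assumes "x \<approx> y"
  shows "grade_involution x \<approx> grade_involution y"
proof -
  define J where "J = {x. grade_involution x \<in> I}"
  have "ideal J ring_of_type_algebra"
    by (rule type_ring_idealI)
       (auto simp: J_def grade_involution_add grade_involution_mult grade_involution_zero
         intro: I_closed)
  moreover have "clifford_relations scale f \<subseteq> J"
  proof
    fix r assume r: "r \<in> clifford_relations scale f"
    then have "grade_involution r = r \<or> grade_involution r = - r"
      by (auto simp: clifford_relations_def grade_involution_diff grade_involution_add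
          grade_involution_mult grade_involution_gen grade_involution_const)
    then show "r \<in> J"
      using relations_subset_ideal[of scale f] r I_closed(3) by (auto simp: J_def)
  qed
  ultimately have "I \<subseteq> J" by (rule clifford_ideal_subset)
  then show ?thesis
    using assms by (auto simp: J_def cong_def grade_involution_diff)
qed

text \<open>A vector orthogonal to every letter of a word anticommutes with each letter, so moving it through
  the word costs exactly the sign of the grade involution. The set \<open>W\<close> consists of the letters of
  \<open>p\<close>.\<close>
lemma orthogonal_twisted_commute:
  "\<exists>W. finite W \<and>
    (\<forall>v. (\<forall>w\<in>W. B w v = 0) \<longrightarrow> free_gen v * p \<approx> grade_involution p * free_gen v)"
proof (induction p rule: free_alg_induct)
  case (single xs c)
  have "free_gen v * Poly_Mapping.single (Word xs) c
      \<approx> grade_involution (Poly_Mapping.single (Word xs) c) * free_gen v"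
    if "\<forall>w\<in>set xs. B w v = 0" for v
    using that
  proof (induction xs)
    case Nil
    then show ?case
      by (simp add: single_Nil grade_involution_const free_const_central)
  next
    case (Cons x xs)
    let ?s = "Poly_Mapping.single (Word xs) c"
    have "free_gen v * free_gen x + free_gen x * free_gen v \<approx> 0"
      using gen_anticommutator[of v x] Cons.prems
      by (simp add: polar_commute[of v] free_const_simps)
    then have "free_gen v * free_gen x \<approx> - (free_gen x * free_gen v)"
      by (simp add: cong_def)
    then have "free_gen v * free_gen x * ?s \<approx> - (free_gen x * free_gen v) * ?s"
      by (rule cong_mult[OF _ cong_refl])
    also have "\<dots> = - free_gen x * (free_gen v * ?s)"
      by (simp add: mult.assoc)
    also have "\<dots> \<approx> - free_gen x * (grade_involution ?s * free_gen v)"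
      using Cons by (intro cong_mult[OF cong_refl]) auto
    finally show ?case
      by (simp add: single_Cons grade_involution_mult grade_involution_gen mult.assoc)
  qed
  then show ?case by (intro exI[of _ "set xs"]) auto
next
  case (add x y)
  then obtain W W' where "finite W" "finite W'"
    and W: "\<And>v. (\<forall>w\<in>W. B w v = 0) \<Longrightarrow> free_gen v * x \<approx> grade_involution x * free_gen v"
    and W': "\<And>v. (\<forall>w\<in>W'. B w v = 0) \<Longrightarrow> free_gen v * y \<approx> grade_involution y * free_gen v"
    by blast
  then show ?case
    by (intro exI[of _ "W \<union> W'"])
       (auto simp: grade_involution_add distrib_left distrib_right intro!: cong_add)
qed

text \<open>The commutator equals \<open>(p - \<alpha> p) v\<close>, a product of two factors that both change sign under the
  grade involution \<open>\<alpha>\<close>, whereas \<open>u\<close> changes sign itself.\<close>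
lemma orthogonal_commutator_zero:
  assumes "nondegenerate f"
    and twist: "free_gen v * p \<approx> grade_involution p * free_gen v"
    and comm: "free_gen u \<approx> p * free_gen v - free_gen v * p"
  shows "u = 0"
proof -
  let ?e = "(p - grade_involution p) * free_gen v"
  have e: "free_gen u \<approx> ?e"
    using cong_trans[OF comm cong_diff[OF cong_refl twist]] by (simp add: left_diff_distrib)
  have "- free_gen u \<approx> ?e"
    using grade_involution_cong[OF e]
    by (simp add: grade_involution_mult grade_involution_diff grade_involution_involution
        grade_involution_gen algebra_simps)
  then have "free_gen u \<approx> - free_gen u"
    using e cong_sym cong_trans by blast
  then show ?thesis
    by (intro gen_cong_zero[OF assms(1)] cong_neg_self)
qed

section \<open>Inner derivations have finite rank\<close>

text \<open>The orthogonal complement of a finite set \<open>W\<close> has finite codimension. For each new element of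
  \<open>W\<close>, either nothing changes or one vector \<open>u\<close>, orthogonal to the old elements only, has to be added
  to the complementary set.\<close>
lemma finite_codimension_orthogonal:
  assumes "finite W"
  shows "\<exists>U. finite U \<and> (\<forall>v. \<exists>s\<in>span U. \<forall>w\<in>W. B w (v - s) = 0)"
  using assms
proof (induction W)
  case empty
  then show ?case by (intro exI[of _ "{}"]) auto
next
  case (insert w W)
  then obtain U where U: "finite U" "\<And>v. \<exists>s\<in>span U. \<forall>w\<in>W. B w (v - s) = 0"
    by blast
  show ?case
  proof (cases "\<exists>u. (\<forall>w\<in>W. B w u = 0) \<and> B w u \<noteq> 0")
    case False
    then show ?thesis
      using U by (intro exI[of _ U]) (metis insert_iff)
  next
    case True
    then obtain u where u: "\<And>w. w \<in> W \<Longrightarrow> B w u = 0" "B w u \<noteq> 0" by blast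
    have "\<exists>s\<in>span (insert u U). \<forall>x\<in>insert w W. B x (v - s) = 0" for v
    proof -
      obtain s where s: "s \<in> span U" "\<And>w. w \<in> W \<Longrightarrow> B w (v - s) = 0"
        using U(2) by blast
      let ?s = "s + scale (B w (v - s) / B w u) u"
      have "?s \<in> span (insert u U)"
        using s(1) span_mono[of U "insert u U"]
        by (intro span_add span_scale span_base[of u]) auto
      moreover have "\<forall>x\<in>insert w W. B x (v - ?s) = 0"
        using u s(2) by (auto simp: polar_diff_right polar_add_right polar_scale_right)
      ultimately show ?thesis by blast
    qed
    then show ?thesis using U(1) by (intro exI[of _ "insert u U"]) simp
  qed
qed

text \<open>The map vanishes on the orthogonal complement of a finite set, so its range is the image of a
  finite-dimensional complement.\<close>
lemma inner_imp_finitary: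
  assumes "nondegenerate f"
    and lin: "Vector_Spaces.linear scale scale \<psi>"
    and inner: "\<And>v. free_gen (\<psi> v) \<approx> p * free_gen v - free_gen v * p"
  shows "finitary \<psi>"
proof -
  interpret psi: Vector_Spaces.linear scale scale \<psi> by fact
  obtain W where W: "finite W"
    "\<And>v. (\<forall>w\<in>W. B w v = 0) \<Longrightarrow> free_gen v * p \<approx> grade_involution p * free_gen v"
    using orthogonal_twisted_commute[of p] by blast
  then have ker: "\<psi> v = 0" if "\<forall>w\<in>W. B w v = 0" for v
    using orthogonal_commutator_zero[OF assms(1) _ inner] that by blast
  obtain U where U: "finite U" "\<And>v. \<exists>s\<in>span U. \<forall>w\<in>W. B w (v - s) = 0"
    using finite_codimension_orthogonal[OF W(1)] by blast
  have "range \<psi> \<subseteq> \<psi> ` span U"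
  proof
    fix y assume "y \<in> range \<psi>"
    then obtain v where v: "y = \<psi> v" by blast
    obtain s where s: "s \<in> span U" "\<forall>w\<in>W. B w (v - s) = 0" using U(2) by blast
    then have "\<psi> v = \<psi> s" using ker[of "v - s"] by (simp add: psi.diff)
    then show "y \<in> \<psi> ` span U" using s v by blast
  qed
  then have range: "range \<psi> = span (\<psi> ` U)"
    by (auto simp: psi.span_image)
  obtain E where E: "E \<subseteq> \<psi> ` U" "independent E" "\<psi> ` U \<subseteq> span E"
    using maximal_independent_subset[of "\<psi> ` U"] by blast
  then have "span E = range \<psi>"
    unfolding range using span_mono[OF E(1)] span_minimal[OF E(3) subspace_span] by auto
  moreover have "finite E"
    using finite_subset[OF E(1)] U(1) by simp
  ultimately show ?thesis
    unfolding finitary_def using E(2) by (intro exI[of _ E] conjI)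
qed

section \<open>Maps of finite rank give inner derivations\<close>

text \<open>To extend a dual system \<open>d\<close> of \<open>E\<close> by \<open>x\<close>, subtract from \<open>x\<close> its expansion in \<open>E\<close>. The result
  is nonzero by independence, so nondegeneracy yields a vector \<open>u\<close> not orthogonal to it. Projecting
  \<open>u\<close> away from the span of the \<open>d e\<close> gives a vector orthogonal to \<open>E\<close> but not to \<open>x\<close>; it is
  normalized for \<open>x\<close> and used to correct the \<open>d e\<close>.\<close>
lemma dual_vectors:
  assumes "nondegenerate f" "finite E" "independent E"
  shows "\<exists>d. \<forall>e\<in>E. \<forall>e'\<in>E. B e (d e') = (if e = e' then 1 else 0)"
  using assms(2,3)
proof (induction E)
  case empty
  then show ?case by simp
next
  case (insert x E)
  then have indep: "independent E" "x \<notin> span E"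
    by (auto simp: independent_insert)
  then obtain d where d: "\<And>e e'. e \<in> E \<Longrightarrow> e' \<in> E \<Longrightarrow> B e (d e') = (if e = e' then 1 else 0)"
    using insert by blast
  define x' where "x' = x - (\<Sum>e\<in>E. scale (B x (d e)) e)"
  have "x' \<noteq> 0"
    using indep(2) span_sum[of E "\<lambda>e. scale (B x (d e)) e" E]
    by (auto simp: x'_def span_scale span_base)
  then obtain u where u: "B x' u \<noteq> 0"
    using assms(1) by (auto simp: nondegenerate_def)
  define w where "w = u - (\<Sum>e\<in>E. scale (B e u) (d e))"
  have wE: "B e w = 0" if "e \<in> E" for e
  proof -
    have "(\<Sum>i\<in>E. B i u * B e (d i)) = (\<Sum>i\<in>E. if i = e then B i u else 0)"
      using that d by (intro sum.cong) auto
    then show ?thesis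
      using that insert.hyps(1)
      by (simp add: w_def polar_diff_right polar_sum_right polar_scale_right)
  qed
  have "B x w = B x' u"
    by (simp add: w_def x'_def polar_diff_right polar_diff_left polar_sum_right polar_sum_left
        polar_scale_right polar_scale_left mult.commute)
  then have xw: "B x w \<noteq> 0" using u by simp
  define d' where "d' e = (if e = x then scale (1 / B x w) w
    else d e - scale (B x (d e) / B x w) w)" for e
  have "B e (d' e') = (if e = e' then 1 else 0)" if "e \<in> insert x E" "e' \<in> insert x E" for e e'
    using that insert.hyps(2) d xw wE
    by (auto simp: d'_def polar_diff_right polar_scale_right)
  then show ?case by blast
qed

text \<open>The derivations of rank at most two: commutation with \<open>e u\<close> maps vectors to vectors, since moving
  \<open>v\<close> past each factor costs one anticommutator.\<close>
lemma gen_pair_commutator: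
  "free_gen e * free_gen u * free_gen v - free_gen v * (free_gen e * free_gen u)
    \<approx> free_gen (scale (B u v) e - scale (B e v) u)"
proof -
  let ?g = "free_gen :: 'v \<Rightarrow> ('v, 'k) free_alg"
  have "?g e * ?g u * ?g v - ?g v * (?g e * ?g u)
      = ?g e * (?g u * ?g v + ?g v * ?g u) - (?g e * ?g v + ?g v * ?g e) * ?g u"
    by (simp add: algebra_simps)
  also have "\<dots> \<approx> ?g e * free_const (B u v) - free_const (B e v) * ?g u"
    by (intro cong_diff cong_mult gen_anticommutator cong_refl)
  also have "\<dots> = free_const (B u v) * ?g e + free_const (- B e v) * ?g u"
    by (simp add: free_const_central free_const_simps)
  also have "\<dots> \<approx> ?g (scale (B u v) e) + ?g (scale (- B e v) u)"
    by (intro cong_add cong_sym[OF gen_scale])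
  also have "\<dots> \<approx> ?g (scale (B u v) e + scale (- B e v) u)"
    by (rule cong_sym[OF gen_add])
  finally show ?thesis by simp
qed

text \<open>The map has two expressions as a sum over \<open>E\<close>, \<open>psi1\<close> from the coordinates of \<open>\<psi> v\<close> and \<open>psi2\<close>
  from those of \<open>v\<close>. The commutator with \<open>\<Sum>e. e \<psi> (d e)\<close> is the difference of the two sums, each
  of which contributes \<open>- \<psi> v\<close>; hence the factor \<open>- 1 / 2\<close>.\<close>
lemma finitary_imp_inner_on_generators:
  assumes "nondegenerate f"
    and lin: "Vector_Spaces.linear scale scale \<psi>"
    and skew: "skew_symmetric f \<psi>" and fin: "finitary \<psi>"
  obtains p where "\<And>v. free_gen (\<psi> v) \<approx> p * free_gen v - free_gen v * p"
proof -
  interpret psi: Vector_Spaces.linear scale scale \<psi> by fact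
  have skew': "B (\<psi> v) w = - B v (\<psi> w)" for v w
    using skew by (simp add: skew_symmetric_def eq_neg_iff_add_eq_0)
  obtain E where E: "finite E" "independent E" "span E = range \<psi>"
    using fin unfolding finitary_def by blast
  obtain d where d: "\<And>e e'. e \<in> E \<Longrightarrow> e' \<in> E \<Longrightarrow> B e (d e') = (if e = e' then 1 else 0)"
    using dual_vectors[OF assms(1) E(1,2)] by blast
  have expand: "\<psi> v = (\<Sum>e\<in>E. scale (B (\<psi> v) (d e)) e)" for v
  proof -
    have "\<psi> v \<in> span E" using E(3) by blast
    then obtain c where c: "\<psi> v = (\<Sum>e\<in>E. scale (c e) e)"
      using span_finite[OF E(1)] by auto
    have "B (\<psi> v) (d e) = c e" if "e \<in> E" for e
    proof -
      have "(\<Sum>i\<in>E. c i * B i (d e)) = (\<Sum>i\<in>E. if i = e then c i else 0)"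
        using that d by (intro sum.cong) auto
      then show ?thesis
        unfolding c using that E(1) by (simp add: polar_sum_left polar_scale_left)
    qed
    then show ?thesis using c by simp
  qed
  have psi1: "(\<Sum>e\<in>E. scale (B (\<psi> (d e)) v) e) = - \<psi> v" for v
    by (subst (2) expand) (simp add: skew' sum_negf polar_commute[of v])
  \<comment> \<open>Replacing \<open>v\<close> by \<open>\<Sum>e. \<langle>e, v\<rangle> (d e)\<close> changes it by a vector orthogonal to the range of \<open>\<psi>\<close>.
    By skew-symmetry, the image of such a vector is orthogonal to everything.\<close>
  have psi2: "(\<Sum>e\<in>E. scale (B e v) (\<psi> (d e))) = \<psi> v" for v
  proof -
    let ?v' = "\<Sum>e\<in>E. scale (B e v) (d e)"
    have "B e (v - ?v') = 0" if "e \<in> E" for e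
    proof -
      have "(\<Sum>i\<in>E. B i v * B e (d i)) = (\<Sum>i\<in>E. if i = e then B i v else 0)"
        using that d by (intro sum.cong) auto
      then show ?thesis
        using that E(1) by (simp add: polar_diff_right polar_sum_right polar_scale_right)
    qed
    then have "B (\<psi> u) (v - ?v') = 0" for u
      by (subst expand) (simp add: polar_sum_left polar_scale_left)
    then have "\<psi> (v - ?v') = 0"
      using assms(1) skew' polar_commute unfolding nondegenerate_def by (metis neg_equal_0_iff_equal)
    then show ?thesis by (simp add: psi.diff psi.sum psi.scale)
  qed
  define p :: "('v, 'k) free_alg"
    where "p = free_const (- 1 / 2) * (\<Sum>e\<in>E. free_gen e * free_gen (\<psi> (d e)))"
  have "free_gen (\<psi> v) \<approx> p * free_gen v - free_gen v * p" for v
  proof -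
    let ?c = "\<lambda>e. scale (B (\<psi> (d e)) v) e - scale (B e v) (\<psi> (d e))"
    have "sum ?c E = - \<psi> v - \<psi> v"
      by (simp only: sum_subtractf psi1 psi2)
    then have half: "scale (- 1 / 2) (sum ?c E) = \<psi> v"
      using two_nonzero by (simp add: scale_right_diff_distrib flip: scale_left_distrib)
    have "p * free_gen v - free_gen v * p = free_const (- 1 / 2) *
        (\<Sum>e\<in>E. free_gen e * free_gen (\<psi> (d e)) * free_gen v
          - free_gen v * (free_gen e * free_gen (\<psi> (d e))))"
    proof -
      let ?S = "\<Sum>e\<in>E. free_gen e * free_gen (\<psi> (d e))"
      have "free_gen v * p = free_const (- 1 / 2) * (free_gen v * ?S)"
        unfolding p_def by (simp only: free_const_central mult.assoc)
      then have "p * free_gen v - free_gen v * p =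
          free_const (- 1 / 2) * (?S * free_gen v - free_gen v * ?S)"
        by (simp add: p_def mult.assoc right_diff_distrib)
      then show ?thesis
        by (simp add: sum_subtractf sum_distrib_left sum_distrib_right)
    qed
    also have "\<dots> \<approx> free_const (- 1 / 2) * (\<Sum>e\<in>E. free_gen (?c e))"
      by (intro cong_mult cong_refl cong_sum gen_pair_commutator)
    also have "\<dots> \<approx> free_const (- 1 / 2) * free_gen (sum ?c E)"
      by (intro cong_mult cong_refl cong_sym[OF gen_sum])
    also have "\<dots> \<approx> free_gen (scale (- 1 / 2) (sum ?c E))"
      by (rule cong_sym[OF gen_scale])
    finally show ?thesis
      unfolding half by (rule cong_sym)
  qed
  then show ?thesis by (rule that)
qed

text \<open>Choosing representatives turns \<open>D\<close> into a map \<open>d\<close> of the free algebra that is a derivation modulo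
  the ideal. The product rule then forces its values on words, starting from \<open>d 1 \<approx> 0\<close>.\<close>
lemma derivation_eq_commutator:
  assumes D: "derivation A D"
    and gens: "\<And>v. D (cls (free_gen v)) = cls (p * free_gen v - free_gen v * p)"
  shows "D (cls x) = cls (p * x - x * p)"
proof -
  have carr: "cls x \<in> carrier A" for x by (simp add: clifford_algebra_ops)
  have "\<forall>x. \<exists>q. D (cls x) = cls q"
    using derivationD(1)[OF D carr] unfolding clifford_algebra_ops by blast
  then obtain d where d: "\<And>x. D (cls x) = cls (d x)" by metis
  have d_add: "d (x + y) \<approx> d x + d y" for x y
    using derivationD(2)[OF D carr carr, of x y]
    unfolding clifford_algebra_ops d class_eq_iff .
  have scale: "d (free_const c * x) \<approx> free_const c * d x" for c x
    using derivationD(3)[OF D carr, of c x]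
    unfolding clifford_algebra_ops d class_eq_iff .
  have mult: "d (x * y) \<approx> d x * y + x * d y" for x y
    using derivationD(4)[OF D carr carr, of x y]
    unfolding clifford_algebra_ops d class_eq_iff .
  have one: "d 1 \<approx> 0"
    using mult[of 1 1] I_closed(3)[of "- d 1"] by (simp add: cong_def)
  have "d x \<approx> p * x - x * p"
  proof (induction x rule: free_alg_induct)
    case (single xs c)
    show ?case
    proof (induction xs)
      case Nil
      have "d (free_const c * 1) \<approx> free_const c * d 1" by (rule scale)
      also have "\<dots> \<approx> free_const c * 0" by (intro cong_mult one cong_refl)
      finally show ?case by (simp add: single_Nil free_const_central)
    next
      case (Cons v xs)
      let ?s = "Poly_Mapping.single (Word xs) c"
      have "d (free_gen v * ?s) \<approx> d (free_gen v) * ?s + free_gen v * d ?s" by (rule mult)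
      also have "\<dots> \<approx> (p * free_gen v - free_gen v * p) * ?s + free_gen v * (p * ?s - ?s * p)"
        using gens by (intro cong_add cong_mult Cons cong_refl) (simp only: class_eq_iff d)
      finally show ?case by (simp add: single_Cons algebra_simps)
    qed
  next
    case (add x y)
    have "d (x + y) \<approx> (p * x - x * p) + (p * y - y * p)"
      by (rule cong_trans[OF d_add cong_add[OF add]])
    then show ?case by (simp add: algebra_simps)
  qed
  then show ?thesis by (simp add: d class_eq_iff)
qed

lemma inner_bogolyubov_iff_finitary:
  assumes nondeg: "nondegenerate f"
    and lin: "Vector_Spaces.linear scale scale \<psi>"
    and skew: "skew_symmetric f \<psi>"
    and D: "bogolyubov_derivation scale f \<psi> D"
  shows "inner_derivation A D \<longleftrightarrow> finitary \<psi>"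
proof
  have der: "derivation A D" and gens: "\<And>v. D (cls (free_gen v)) = cls (free_gen (\<psi> v))"
    using D by (simp_all add: bogolyubov_derivation_def clifford_embed_def)
  show "finitary \<psi>" if "inner_derivation A D"
  proof -
    obtain a where "a \<in> carrier A"
      and a: "\<forall>x\<in>carrier A. D x = (a \<otimes>\<^bsub>A\<^esub> x) \<ominus>\<^bsub>A\<^esub> (x \<otimes>\<^bsub>A\<^esub> a)"
      using \<open>inner_derivation A D\<close> unfolding inner_derivation_def by (elim conjE bexE)
    then obtain p where "a = cls p" by (auto simp: clifford_algebra_ops)
    then have "D (cls x) = cls (p * x - x * p)" for x
      using a by (simp add: clifford_algebra_ops)
    then have "free_gen (\<psi> v) \<approx> p * free_gen v - free_gen v * p" for v
      using gens unfolding class_eq_iff[symmetric] by simp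
    then show ?thesis by (rule inner_imp_finitary[OF nondeg lin])
  qed
  show "inner_derivation A D" if fin: "finitary \<psi>"
  proof -
    from finitary_imp_inner_on_generators[OF nondeg lin skew fin]
    obtain p where p: "free_gen (\<psi> v) \<approx> p * free_gen v - free_gen v * p" for v
      by metis
    have "D (cls x) = cls (p * x - x * p)" for x
      by (rule derivation_eq_commutator[OF der]) (simp only: gens class_eq_iff p)
    then have "\<forall>x\<in>carrier A. D x = (cls p \<otimes>\<^bsub>A\<^esub> x) \<ominus>\<^bsub>A\<^esub> (x \<otimes>\<^bsub>A\<^esub> cls p)"
      by (auto simp: clifford_algebra_ops)
    moreover have "cls p \<in> carrier A" by (simp add: clifford_algebra_ops)
    ultimately show ?thesis
      using der unfolding inner_derivation_def by (intro conjI bexI)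
  qed
qed

end

theorem corollary1:
  fixes scale :: "'k::alg_closed_field \<Rightarrow> 'v::ab_group_add \<Rightarrow> 'v"
    and f :: "'v \<Rightarrow> 'k"
    and \<psi> :: "'v \<Rightarrow> 'v"
    and D :: "('v, 'k) free_alg set \<Rightarrow> ('v, 'k) free_alg set"
  assumes "CHAR('k) \<noteq> 2"
    and "vector_space scale"
    and "vector_space.countably_infinite_dimensional scale"
    and "quadratic_form scale f" and "nondegenerate f"
    and "Vector_Spaces.linear scale scale \<psi>" and "skew_symmetric f \<psi>"
    and "bogolyubov_derivation scale f \<psi> D"
  shows "inner_derivation (clifford_algebra scale f) D \<longleftrightarrow> vector_space.finitary scale \<psi>"
proof -
  have "(of_nat 2 :: 'k) \<noteq> 0"
  proof
    assume "(of_nat 2 :: 'k) = 0"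
    then have "CHAR('k) dvd 2" by (simp only: of_nat_eq_0_iff_char_dvd)
    then have "CHAR('k) = 1"
      using assms(1) two_is_prime_nat by (auto simp: prime_nat_iff)
    then show False by simp
  qed
  then interpret quadratic_space scale f
    using assms by (intro quadratic_space.intro quadratic_space_axioms.intro) simp_all
  show ?thesis by (rule inner_bogolyubov_iff_finitary) fact+
qed

end
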